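(* Fix $d\ge 3$, $\delta<1$, $c>0$, $p=(c+o_n(1))n^{-d+1+\delta}$, and let $\mathcal{H}$ be the random $d$-uniform hypergraph on $[n]$ with each $d$-subset a hyperedge independently with probability $p$. Let $q$ be the probability that every pair $\{i,j\}\subset[d]$ is an edge of $\mathrm{Proj}(\mathcal{H})$. Then \[ q=(1+o_n(1))\left(p+\left(\frac{c\,n^{\delta-1}}{(d-2)!}\right)^{\binom{d}{2}}\right). \]
   Context: $\mathrm{Proj}(H)$ is the graph on $[n]$ with $\{i,j\}$ an edge iff some hyperedge of $H$ contains $\{i,j\}$. Asymptotics are as $n\to\infty$. *)

theory Defs
  imports "HOL-Probability.Probability" "HOL-Library.Landau_Symbols"
begin

definition uniform_edges :: "nat \<Rightarrow> nat \<Rightarrow> nat set set" where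
  "uniform_edges d n = {e. e \<subseteq> {1..n} \<and> card e = d}"

text \<open>
  A hypergraph on the vertex set \<open>{1..n}\<close> is given by its set of hyperedges. The value
  \<open>False\<close> is only the junk value of \<^const>\<open>Pi_pmf\<close> outside its index set.
  Note that \<^const>\<open>bernoulli_pmf\<close> clips its parameter to the interval from 0 to 1.
\<close>
definition random_hypergraph :: "nat \<Rightarrow> nat \<Rightarrow> real \<Rightarrow> nat set set pmf" where
  "random_hypergraph d n p =
     map_pmf (\<lambda>X. {e \<in> uniform_edges d n. X e})
       (Pi_pmf (uniform_edges d n) False (\<lambda>_. bernoulli_pmf p))"

text \<open>The projected graph on the vertex set \<open>{1..n}\<close>, given by its set of edges.\<close>
definition Proj :: "nat \<Rightarrow> nat set set \<Rightarrow> nat set set" where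
  "Proj n H = {{i, j} | i j. i \<in> {1..n} \<and> j \<in> {1..n} \<and> i \<noteq> j \<and> (\<exists>e\<in>H. {i, j} \<subseteq> e)}"

definition proj_clique_prob :: "nat \<Rightarrow> nat \<Rightarrow> real \<Rightarrow> real" where
  "proj_clique_prob d n p =
     measure_pmf.prob (random_hypergraph d n p)
       {H. \<forall>i\<in>{1..d}. \<forall>j\<in>{1..d}. i \<noteq> j \<longrightarrow> {i, j} \<in> Proj n H}"

end

theory Submission
  imports Defs
begin

text \<open>
  For \<open>S \<subseteq> [d]\<close> let \<open>E\<^sub>S\<close> be the event that some hyperedge \<open>e\<close> has trace \<open>e \<inter> [d] = S\<close>. The
  hyperedges with different traces are different, so these events are independent, and for \<open>|S| = s\<close>
  the probability of \<open>E\<^sub>S\<close> is asymptotic to \<open>c n\<^bsup>1+\<delta>-s\<^esup> / (d-s)!\<close>. All pairs of \<open>[d]\<close> are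
  edges of the projection iff the traces that occur cover all pairs. The covers \<open>{[d]}\<close> and
  \<open>{P. |P| = 2}\<close> contribute the two main terms. Every other relevant cover \<open>T\<close> has probability
  of order \<open>n\<^bsup>a\<^esup>\<close> with \<open>a = (\<Sum>S\<in>T. 1+\<delta>-|S|)\<close>, and this exponent is strictly smaller than
  the larger one of the two main exponents. As functions of \<open>x = 1-\<delta>\<close> the exponents are linear
  with slopes \<open>-|T|\<close>, -1 and \<open>-(d choose 2)\<close>, and \<open>1 \<le> |T| \<le> (d choose 2)\<close>, so it is enough to
  compare at the crossing point \<open>x = 2/(d+1)\<close> of the two main exponents, where the inequality
  follows from \<open>(s-2)(d-s) \<ge> 0\<close> for each trace, strictly so for some trace.
\<close>

section \<open>Independence of Bernoulli variables on disjoint index sets\<close>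

text \<open>
  The library version assumes countable sets; only the intersections with the supports matter.
\<close>

lemma prob_pair_pmf_Times:
  "measure_pmf.prob (pair_pmf M N) (A \<times> B) = measure_pmf.prob M A * measure_pmf.prob N B"
proof -
  have "measure_pmf.prob (pair_pmf M N) (A \<times> B) =
      measure_pmf.prob (pair_pmf M N) ((A \<inter> set_pmf M) \<times> (B \<inter> set_pmf N))"
    by (subst measure_Int_set_pmf [symmetric]) (simp add: Times_Int_Times)
  also have "\<dots> = measure_pmf.prob M (A \<inter> set_pmf M) * measure_pmf.prob N (B \<inter> set_pmf N)"
    by (rule measure_pmf_prob_product) auto
  finally show ?thesis
    by (simp add: measure_Int_set_pmf)
qed

lemma prob_Pi_bernoulli_Bex:
  fixes p :: real
  assumes "finite B" "0 \<le> p" "p \<le> 1"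
  shows "measure_pmf.prob (Pi_pmf B False (\<lambda>_. bernoulli_pmf p)) {X. \<exists>e\<in>B. X e} =
    1 - (1 - p) ^ card B"
proof -
  let ?M = "Pi_pmf B False (\<lambda>_. bernoulli_pmf p)"
  have "{X. \<exists>e\<in>B. X e} = UNIV - Pi B (\<lambda>_. {False})"
    by (auto simp: Pi_def)
  then have "measure_pmf.prob ?M {X. \<exists>e\<in>B. X e} = 1 - measure_pmf.prob ?M (Pi B (\<lambda>_. {False}))"
    using measure_pmf.prob_compl [of "Pi B (\<lambda>_. {False})" ?M] by simp
  also have "measure_pmf.prob ?M (Pi B (\<lambda>_. {False})) = (1 - p) ^ card B"
    using assms measure_Pi_pmf_Pi [of B False "\<lambda>_. bernoulli_pmf p" "\<lambda>_. {False}"]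
    by (simp add: measure_pmf_single)
  finally show ?thesis .
qed

text \<open>Induction on \<open>T\<close>: the coordinates in \<open>B S\<close> are split off,
  being independent of the rest and irrelevant to the other blocks. The index set shrinks to
  \<open>U - B S\<close>, so \<open>U\<close> has to be arbitrary in the induction.\<close>

lemma prob_Pi_bernoulli_Ball_Bex:
  fixes p :: real
  assumes "finite T" "finite U" "0 \<le> p" "p \<le> 1"
    and "\<And>S. S \<in> T \<Longrightarrow> B S \<subseteq> U" "disjoint_family_on B T"
  shows "measure_pmf.prob (Pi_pmf U False (\<lambda>_. bernoulli_pmf p)) {X. \<forall>S\<in>T. \<exists>e\<in>B S. X e} =
    (\<Prod>S\<in>T. 1 - (1 - p) ^ card (B S))"
  using assms(1,2,5,6)
proof (induction T arbitrary: U rule: finite_induct)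
  case empty
  then show ?case by simp
next
  case (insert S T)
  let ?P = "\<lambda>V. Pi_pmf V False (\<lambda>_. bernoulli_pmf p)"
  let ?E = "{X. \<exists>e\<in>B S. X e}" and ?F = "{X. \<forall>S\<in>T. \<exists>e\<in>B S. X e}"
  have fin: "finite (B S)"
    using insert.prems by (meson finite_subset insertI1)
  have U: "U = B S \<union> (U - B S)"
    using insert.prems by auto
  have disj: "B S \<inter> B S' = {}" if "S' \<in> T" for S'
    using insert.prems(3) insert.hyps(2) that by (auto simp: disjoint_family_on_def)
  have iff: "(\<exists>e\<in>B S'. if e \<in> B S then f e else g e) \<longleftrightarrow> (\<exists>e\<in>B S'. g e)"
    if "S' \<in> T" for S' and f g :: "'b \<Rightarrow> bool"
    using disj [OF that] by (intro bex_cong) auto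
  have iff': "(\<exists>e\<in>B S. if e \<in> B S then f e else g e) \<longleftrightarrow> (\<exists>e\<in>B S. f e)" for f g :: "'b \<Rightarrow> bool"
    by auto
  \<comment> \<open>\<open>Pi_pmf_union\<close> draws \<open>f\<close> on \<open>B S\<close> and
    \<open>g\<close> on the remaining indices and glues them. The condition for \<open>S\<close>
    sees only \<open>f\<close>; by disjointness those for \<open>T\<close> see only
    \<open>g\<close>, so the preimage is a rectangle.\<close>
  have vimage: "(\<lambda>(f, g) x. if x \<in> B S then f x else g x) -` {X. \<forall>S\<in>insert S T. \<exists>e\<in>B S. X e} = ?E \<times> ?F"
    by (auto simp only: vimage_eq mem_Collect_eq Set.ball_simps prod.case if_True iff iff' mem_Times_iff
        fst_conv snd_conv cong: ball_cong)
  have "measure_pmf.prob (?P U) {X. \<forall>S\<in>insert S T. \<exists>e\<in>B S. X e} =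
      measure_pmf.prob (pair_pmf (?P (B S)) (?P (U - B S))) (?E \<times> ?F)"
    using insert.prems fin
    by (subst U, subst Pi_pmf_union) (auto simp: vimage [symmetric])
  also have "\<dots> = measure_pmf.prob (?P (B S)) ?E * measure_pmf.prob (?P (U - B S)) ?F"
    by (rule prob_pair_pmf_Times)
  also have "measure_pmf.prob (?P (B S)) ?E = 1 - (1 - p) ^ card (B S)"
    using fin assms(3,4) by (rule prob_Pi_bernoulli_Bex)
  also have "measure_pmf.prob (?P (U - B S)) ?F = (\<Prod>S\<in>T. 1 - (1 - p) ^ card (B S))"
  proof (rule insert.IH)
    show "B S' \<subseteq> U - B S" if "S' \<in> T" for S'
      using insert.prems(2) [of S'] disj [OF that] that by blast
    show "disjoint_family_on B T"
      using insert.prems(3) by (simp add: disjoint_family_on_def)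
  qed (use insert.prems(1) in simp)
  finally show ?case
    using insert.hyps by simp
qed

section \<open>Hyperedges sorted by their trace on [d]\<close>

definition trace_class :: "nat \<Rightarrow> nat \<Rightarrow> nat set \<Rightarrow> nat set set" where
  "trace_class d n S = {e \<in> uniform_edges d n. e \<inter> {1..d} = S}"

definition pairs :: "nat \<Rightarrow> nat set set" where
  "pairs d = {P. P \<subseteq> {1..d} \<and> card P = 2}"

text \<open>
  Choosing one hyperedge for each pair shows that at most \<open>d choose 2\<close> traces suffice. The bound on
  \<open>card T\<close> makes the redundant covers negligible when \<open>\<delta>\<close> is close to 1.
\<close>

definition covers :: "nat \<Rightarrow> nat set set set" where
  "covers d = {T. T \<subseteq> {S. S \<subseteq> {1..d} \<and> 2 \<le> card S \<and> card S < d} \<and> card T \<le> d choose 2 \<and>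
     (\<forall>P\<in>pairs d. \<exists>S\<in>T. P \<subseteq> S)}"

text \<open>For \<open>s \<le> d \<le> n\<close> and \<open>p\<close> in [0,1], this is the
  probability that some hyperedge meets [d] exactly in a given set of size \<open>s\<close>. The
  binomial coefficient counts the candidates for such a hyperedge.\<close>

definition trace_prob :: "nat \<Rightarrow> nat \<Rightarrow> real \<Rightarrow> nat \<Rightarrow> real" where
  "trace_prob d n p s = 1 - (1 - p) ^ ((n - d) choose (d - s))"

lemma finite_uniform_edges [simp]: "finite (uniform_edges d n)"
  by (simp add: uniform_edges_def)

lemma trace_class_subset: "trace_class d n S \<subseteq> uniform_edges d n"
  by (auto simp: trace_class_def)

lemma finite_pairs: "finite (pairs d)"
  by (simp add: pairs_def)

lemma card_pairs: "card (pairs d) = d choose 2"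
  using n_subsets [of "{1..d}" 2] by (simp add: pairs_def)

lemma finite_covers: "finite (covers d)"
  by (rule finite_subset [of _ "Pow (Pow {1..d})"]) (auto simp: covers_def)

text \<open>A hyperedge with trace \<open>S\<close> is determined by its other
  \<open>d - card S\<close> vertices, chosen freely among the \<open>n - d\<close> vertices outside
  [d].\<close>

lemma card_trace_class:
  assumes "S \<subseteq> {1..d}" "d \<le> n"
  shows "card (trace_class d n S) = (n - d) choose (d - card S)"
proof -
  have fin: "finite S"
    using assms(1) by (rule finite_subset) simp
  have le: "card S \<le> d"
    using card_mono [OF _ assms(1)] by simp
  have bij: "bij_betw (\<lambda>R. R \<union> S) {R. R \<subseteq> {Suc d..n} \<and> card R = d - card S} (trace_class d n S)"
  proof (rule bij_betw_byWitness [where f' = "\<lambda>e. e - {1..d}"])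
    show "\<forall>R\<in>{R. R \<subseteq> {Suc d..n} \<and> card R = d - card S}. R \<union> S - {1..d} = R"
      using assms by fastforce
    show "\<forall>e\<in>trace_class d n S. e - {1..d} \<union> S = e"
      by (auto simp: trace_class_def)
    show "(\<lambda>R. R \<union> S) ` {R. R \<subseteq> {Suc d..n} \<and> card R = d - card S} \<subseteq> trace_class d n S"
    proof clarify
      fix R assume R: "R \<subseteq> {Suc d..n}" "card R = d - card S"
      have "finite R" using R(1) by (rule finite_subset) simp
      moreover have "R \<inter> S = {}" "R \<inter> {1..d} = {}" using R assms by fastforce+
      ultimately have "card (R \<union> S) = d" "(R \<union> S) \<inter> {1..d} = S"
        using R(2) assms(1) fin le by (auto simp: card_Un_disjoint)
      moreover have "R \<union> S \<subseteq> {1..n}"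
        using R(1) assms by fastforce
      ultimately show "R \<union> S \<in> trace_class d n S"
        by (simp add: trace_class_def uniform_edges_def)
    qed
    show "(\<lambda>e. e - {1..d}) ` trace_class d n S \<subseteq> {R. R \<subseteq> {Suc d..n} \<and> card R = d - card S}"
    proof clarify
      fix e assume "e \<in> trace_class d n S"
      then have e: "e \<subseteq> {1..n}" "card e = d" "e \<inter> {1..d} = S"
        by (auto simp: trace_class_def uniform_edges_def)
      have "card (e - {1..d}) = d - card S"
        using e(2,3) fin by (subst card_Diff_subset_Int) auto
      moreover have "e - {1..d} \<subseteq> {Suc d..n}"
        using e(1) by auto
      ultimately show "e - {1..d} \<subseteq> {Suc d..n} \<and> card (e - {1..d}) = d - card S"
        by blast
    qed
  qed
  show ?thesis
    using bij_betw_same_card [OF bij] n_subsets [of "{Suc d..n}" "d - card S"] by simp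
qed

lemma prob_traces:
  assumes "T \<subseteq> Pow {1..d}" "d \<le> n" "0 \<le> p" "p \<le> 1"
  shows "measure_pmf.prob (Pi_pmf (uniform_edges d n) False (\<lambda>_. bernoulli_pmf p))
      {X. \<forall>S\<in>T. \<exists>e\<in>trace_class d n S. X e} = (\<Prod>S\<in>T. trace_prob d n p (card S))"
proof -
  have "finite T"
    using assms(1) by (rule finite_subset) simp
  moreover have "disjoint_family_on (trace_class d n) T"
    by (auto simp: disjoint_family_on_def trace_class_def)
  ultimately have "measure_pmf.prob (Pi_pmf (uniform_edges d n) False (\<lambda>_. bernoulli_pmf p))
      {X. \<forall>S\<in>T. \<exists>e\<in>trace_class d n S. X e} = (\<Prod>S\<in>T. 1 - (1 - p) ^ card (trace_class d n S))"
    using assms(3,4) by (intro prob_Pi_bernoulli_Ball_Bex) (simp_all add: trace_class_subset)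
  also have "\<dots> = (\<Prod>S\<in>T. trace_prob d n p (card S))"
    using assms by (intro prod.cong refl) (auto simp: trace_prob_def card_trace_class)
  finally show ?thesis .
qed

lemma trace_prob_self [simp]: "trace_prob d n p d = p"
  by (simp add: trace_prob_def)

lemma doubleton_in_Proj_iff:
  "{i, j} \<in> Proj n H \<longleftrightarrow> i \<in> {1..n} \<and> j \<in> {1..n} \<and> i \<noteq> j \<and> (\<exists>e\<in>H. {i, j} \<subseteq> e)"
proof
  assume "{i, j} \<in> Proj n H"
  then obtain i' j' where "{i, j} = {i', j'}" "i' \<in> {1..n}" "j' \<in> {1..n}" "i' \<noteq> j'"
    and "\<exists>e\<in>H. {i', j'} \<subseteq> e"
    by (auto simp: Proj_def)
  then show "i \<in> {1..n} \<and> j \<in> {1..n} \<and> i \<noteq> j \<and> (\<exists>e\<in>H. {i, j} \<subseteq> e)"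
    by (auto simp: doubleton_eq_iff)
qed (unfold Proj_def, blast)

lemma proj_clique_iff:
  assumes "d \<le> n"
  shows "(\<forall>i\<in>{1..d}. \<forall>j\<in>{1..d}. i \<noteq> j \<longrightarrow> {i, j} \<in> Proj n {e \<in> uniform_edges d n. X e}) \<longleftrightarrow>
    (\<forall>P\<in>pairs d. \<exists>e\<in>uniform_edges d n. X e \<and> P \<subseteq> e)" (is "?L \<longleftrightarrow> ?R")
proof
  assume L: ?L
  show ?R
  proof
    fix P assume "P \<in> pairs d"
    then obtain i j where P: "P = {i, j}" "i \<noteq> j" "i \<in> {1..d}" "j \<in> {1..d}"
      by (auto simp: pairs_def card_2_iff)
    then have "{i, j} \<in> Proj n {e \<in> uniform_edges d n. X e}"
      using L by simp
    then show "\<exists>e\<in>uniform_edges d n. X e \<and> P \<subseteq> e"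
      unfolding doubleton_in_Proj_iff P(1) by auto
  qed
next
  assume R: ?R
  show ?L
  proof (intro ballI impI)
    fix i j assume ij: "i \<in> {1..d}" "j \<in> {1..d}" "i \<noteq> j"
    then have "{i, j} \<in> pairs d"
      by (auto simp: pairs_def)
    with R have "\<exists>e\<in>uniform_edges d n. X e \<and> {i, j} \<subseteq> e"
      by (rule bspec)
    then show "{i, j} \<in> Proj n {e \<in> uniform_edges d n. X e}"
      unfolding doubleton_in_Proj_iff using ij assms by auto
  qed
qed

lemma proj_clique_prob_eq:
  assumes "d \<le> n"
  shows "proj_clique_prob d n p =
    measure_pmf.prob (Pi_pmf (uniform_edges d n) False (\<lambda>_. bernoulli_pmf p))
      {X. \<forall>P\<in>pairs d. \<exists>e\<in>uniform_edges d n. X e \<and> P \<subseteq> e}"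
  by (simp add: proj_clique_prob_def random_hypergraph_def vimage_def proj_clique_iff [OF assms]
      del: One_nat_def)

text \<open>Pick one hyperedge for each pair and collect the traces. Each contains a pair, so it has
  at least two elements; each is proper because the trace [d] is excluded.\<close>

lemma cover_of_traces:
  assumes "\<forall>P\<in>pairs d. \<exists>e\<in>uniform_edges d n. X e \<and> P \<subseteq> e"
    and "\<not> (\<exists>e\<in>trace_class d n {1..d}. X e)"
  shows "\<exists>T\<in>covers d. \<forall>S\<in>T. \<exists>e\<in>trace_class d n S. X e"
proof -
  obtain f where f: "\<And>P. P \<in> pairs d \<Longrightarrow> f P \<in> uniform_edges d n \<and> X (f P) \<and> P \<subseteq> f P"
    using assms(1) by metis
  define T where "T = (\<lambda>P. f P \<inter> {1..d}) ` pairs d"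
  have "2 \<le> card (f P \<inter> {1..d}) \<and> card (f P \<inter> {1..d}) < d" if P: "P \<in> pairs d" for P
  proof
    have "P \<subseteq> f P \<inter> {1..d}" "card P = 2"
      using f [OF P] P by (auto simp: pairs_def)
    then show "2 \<le> card (f P \<inter> {1..d})"
      by (metis card_mono finite_Int finite_atLeastAtMost)
    have "f P \<inter> {1..d} \<noteq> {1..d}"
      using assms(2) f [OF P] by (auto simp: trace_class_def)
    then have "f P \<inter> {1..d} \<subset> {1..d}"
      by blast
    then show "card (f P \<inter> {1..d}) < d"
      using psubset_card_mono [of "{1..d}" "f P \<inter> {1..d}"] by simp
  qed
  moreover have "card T \<le> d choose 2"
    unfolding T_def card_pairs [symmetric] by (rule card_image_le [OF finite_pairs])
  moreover have "\<forall>P\<in>pairs d. \<exists>S\<in>T. P \<subseteq> S"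
  proof
    fix P assume "P \<in> pairs d"
    then have "P \<subseteq> f P \<inter> {1..d}" "f P \<inter> {1..d} \<in> T"
      using f [of P] by (auto simp: T_def pairs_def)
    then show "\<exists>S\<in>T. P \<subseteq> S"
      by blast
  qed
  ultimately have "T \<in> covers d"
    by (auto simp: covers_def T_def)
  moreover have "\<forall>S\<in>T. \<exists>e\<in>trace_class d n S. X e"
    using f by (auto simp: T_def trace_class_def)
  ultimately show ?thesis
    by blast
qed

text \<open>Union bound: either the trace [d] occurs, which has probability \<open>p\<close>, or all
  traces of some cover occur.\<close>

lemma proj_clique_prob_le:
  assumes "d \<le> n" "0 \<le> p" "p \<le> 1"
  shows "proj_clique_prob d n p \<le> p + (\<Sum>T\<in>covers d. \<Prod>S\<in>T. trace_prob d n p (card S))"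
proof -
  define M where "M = measure_pmf (Pi_pmf (uniform_edges d n) False (\<lambda>_. bernoulli_pmf p))"
  define E where "E T = {X. \<forall>S\<in>T. \<exists>e\<in>trace_class d n S. X e}" for T
  have prob_E: "measure M (E T) = (\<Prod>S\<in>T. trace_prob d n p (card S))" if "T \<subseteq> Pow {1..d}" for T
    unfolding M_def E_def using that assms by (rule prob_traces)
  have sub: "{X. \<forall>P\<in>pairs d. \<exists>e\<in>uniform_edges d n. X e \<and> P \<subseteq> e} \<subseteq>
      E {{1..d}} \<union> (\<Union>T\<in>covers d. E T)"
  proof
    fix X assume "X \<in> {X. \<forall>P\<in>pairs d. \<exists>e\<in>uniform_edges d n. X e \<and> P \<subseteq> e}"
    then have "(\<exists>e\<in>trace_class d n {1..d}. X e) \<or> (\<exists>T\<in>covers d. \<forall>S\<in>T. \<exists>e\<in>trace_class d n S. X e)"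
      using cover_of_traces [of d n X] by (simp only: mem_Collect_eq) metis
    then show "X \<in> E {{1..d}} \<union> (\<Union>T\<in>covers d. E T)"
      by (simp add: E_def)
  qed
  have "proj_clique_prob d n p \<le> measure M (E {{1..d}} \<union> (\<Union>T\<in>covers d. E T))"
    unfolding proj_clique_prob_eq [OF assms(1)] M_def
    by (rule measure_pmf.finite_measure_mono [OF sub]) simp
  also have "\<dots> \<le> measure M (E {{1..d}}) + measure M (\<Union>T\<in>covers d. E T)"
    unfolding M_def by (rule measure_Un_le) auto
  also have "measure M (\<Union>T\<in>covers d. E T) \<le> (\<Sum>T\<in>covers d. measure M (E T))"
    unfolding M_def by (rule measure_UNION_le [OF finite_covers]) simp
  also have "\<dots> = (\<Sum>T\<in>covers d. \<Prod>S\<in>T. trace_prob d n p (card S))"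
    by (intro sum.cong refl prob_E) (auto simp: covers_def)
  also have "measure M (E {{1..d}}) = p"
    using prob_E [of "{{1..d}}"] by simp
  finally show ?thesis
    by simp
qed

text \<open>Inclusion-exclusion for two sufficient events: [d] occurs as a trace, or every pair
  does. As \<open>d \<ge> 3\<close>, [d] is not itself a pair, so the two events are
  independent.\<close>

lemma proj_clique_prob_ge:
  assumes "d \<ge> 3" "d \<le> n" "0 \<le> p" "p \<le> 1"
  shows "proj_clique_prob d n p \<ge> p + (1 - p) * trace_prob d n p 2 ^ (d choose 2)"
proof -
  define M where "M = measure_pmf (Pi_pmf (uniform_edges d n) False (\<lambda>_. bernoulli_pmf p))"
  define E where "E T = {X. \<forall>S\<in>T. \<exists>e\<in>trace_class d n S. X e}" for T
  define r where "r = trace_prob d n p 2 ^ (d choose 2)"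
  have prob_E: "measure M (E T) = (\<Prod>S\<in>T. trace_prob d n p (card S))" if "T \<subseteq> Pow {1..d}" for T
    unfolding M_def E_def using that assms(2-4) by (rule prob_traces)
  have notin: "{1..d} \<notin> pairs d"
    using assms(1) by (simp add: pairs_def)
  have sub: "pairs d \<subseteq> Pow {1..d}"
    by (auto simp: pairs_def)
  have r: "(\<Prod>S\<in>pairs d. trace_prob d n p (card S)) = r"
    unfolding r_def card_pairs [symmetric] prod_constant [symmetric]
    by (intro prod.cong) (auto simp: pairs_def)
  have "measure M (E {{1..d}}) = p"
    using prob_E [of "{{1..d}}"] by simp
  moreover have "measure M (E (pairs d)) = r"
    using prob_E [OF sub] r by simp
  moreover have "measure M (E (insert {1..d} (pairs d))) = p * r"
    using prob_E [of "insert {1..d} (pairs d)"] sub notin r by (simp add: finite_pairs)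
  moreover have "E {{1..d}} \<inter> E (pairs d) = E (insert {1..d} (pairs d))"
    by (auto simp: E_def)
  moreover have "measure M (E {{1..d}} \<union> E (pairs d)) =
      measure M (E {{1..d}}) + measure M (E (pairs d)) - measure M (E {{1..d}} \<inter> E (pairs d))"
    unfolding M_def by (rule measure_Un3) (simp_all add: measure_pmf.fmeasurable_eq_sets)
  ultimately have "p + (1 - p) * r = measure M (E {{1..d}} \<union> E (pairs d))"
    by (simp add: algebra_simps)
  also have "\<dots> \<le> proj_clique_prob d n p"
    unfolding proj_clique_prob_eq [OF assms(2)] M_def
  proof (rule measure_pmf.finite_measure_mono)
    have "\<exists>e\<in>uniform_edges d n. X e \<and> P \<subseteq> e"
      if X: "X \<in> E {{1..d}} \<union> E (pairs d)" and P: "P \<in> pairs d" for X P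
    proof -
      have "(\<exists>e\<in>trace_class d n {1..d}. X e) \<or> (\<exists>e\<in>trace_class d n P. X e)"
        using X P by (auto simp: E_def)
      then obtain S e where "S = {1..d} \<or> S = P" "e \<in> trace_class d n S" "X e"
        by metis
      moreover from this have "P \<subseteq> e"
        using P by (auto simp: trace_class_def pairs_def)
      ultimately show ?thesis
        using trace_class_subset by blast
    qed
    then show "E {{1..d}} \<union> E (pairs d) \<subseteq> {X. \<forall>P\<in>pairs d. \<exists>e\<in>uniform_edges d n. X e \<and> P \<subseteq> e}"
      by (simp only: subset_iff mem_Collect_eq) metis
  qed simp
  finally show ?thesis
    by (simp add: r_def)
qed

section \<open>Estimates for trace probabilities and binomial coefficients\<close>

lemma trace_prob_le:
  assumes "0 \<le> p" "p \<le> 1"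
  shows "trace_prob d n p s \<le> real ((n - d) choose (d - s)) * p"
  using Bernoulli_inequality [of "- p" "(n - d) choose (d - s)"] assms by (simp add: trace_prob_def)

text \<open>Together with \<open>trace_prob_le\<close> this encloses the trace probability between
  \<open>1 - exp (- y)\<close> and \<open>y\<close>, where \<open>y\<close> is the expected number
  of hyperedges with the given trace. The two bounds are asymptotic to each other as
  \<open>y\<close> tends to 0.\<close>

lemma trace_prob_ge:
  assumes "0 \<le> p" "p \<le> 1"
  shows "1 - exp (- (real ((n - d) choose (d - s)) * p)) \<le> trace_prob d n p s"
proof -
  have "(1 - p) ^ ((n - d) choose (d - s)) \<le> exp (- p) ^ ((n - d) choose (d - s))"
    using assms exp_ge_add_one_self [of "- p"] by (intro power_mono) auto
  also have "\<dots> = exp (- (real ((n - d) choose (d - s)) * p))"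
    by (simp add: exp_of_nat_mult [symmetric])
  finally show ?thesis
    by (simp add: trace_prob_def)
qed

text \<open>The known asymptotics of \<open>(k + m) choose m\<close> is used at
  \<open>m = n - (d + k)\<close>. For \<open>n \<ge> d + k\<close> the subtraction is not truncated
  and symmetry gives the stated coefficient; finally \<open>m\<close> is asymptotic to
  \<open>n\<close>.\<close>

lemma binomial_shift_asymp_equiv:
  "(\<lambda>n. real ((n - d) choose k)) \<sim>[sequentially] (\<lambda>n. real n ^ k / fact k)"
proof -
  define h where "h n = n - (d + k)" for n
  have h: "filterlim h sequentially sequentially"
    unfolding h_def by (rule filterlim_minus_const_nat_at_top)
  have "(\<lambda>n. real ((k + n) choose n)) \<sim>[sequentially] (\<lambda>n. real n ^ k / fact k)"
    using binomial_asymptotic' [of k, where 'a = real]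
    by (intro asymp_equivI'_const [where c = 1, simplified]) (simp_all)
  from asymp_equiv_compose' [OF this h]
  have "(\<lambda>n. real ((k + h n) choose h n)) \<sim>[sequentially] (\<lambda>n. real (h n) ^ k / fact k)" .
  moreover have "\<forall>\<^sub>F n in sequentially. real ((k + h n) choose h n) = real ((n - d) choose k)"
    using eventually_ge_at_top [of "d + k"]
  proof eventually_elim
    case (elim n)
    then have "k + h n = n - d" "h n = (n - d) - k" "k \<le> n - d"
      by (auto simp: h_def)
    then show ?case
      by (metis binomial_symmetric)
  qed
  ultimately have "(\<lambda>n. real ((n - d) choose k)) \<sim>[sequentially] (\<lambda>n. real (h n) ^ k / fact k)"
    by (simp only: asymp_equiv_cong [OF _ always_eventually [OF allI [OF refl]]])
  also have "(\<lambda>n. real (h n) ^ k / fact k) \<sim>[sequentially] (\<lambda>n. real n ^ k / fact k)"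
  proof (intro asymp_equiv_intros)
    have "(\<lambda>n. real n - real (d + k)) \<sim>[sequentially] real"
      unfolding asymp_equiv_altdef
      using lim_const_over_n [of "- real (d + k)"] by (intro smalloI_tendsto) auto
    moreover have "\<forall>\<^sub>F n in sequentially. real n - real (d + k) = real (h n)"
      using eventually_ge_at_top [of "d + k"] by eventually_elim (simp add: h_def)
    ultimately show "(\<lambda>n. real (h n)) \<sim>[sequentially] real"
      by (simp only: asymp_equiv_cong [OF _ always_eventually [OF allI [OF refl]]])
  qed
  finally show ?thesis .
qed

lemma one_minus_exp_asymp_equiv: "(\<lambda>y::real. 1 - exp (- y)) \<sim>[at 0] (\<lambda>y. y)"
proof (rule asymp_equivI')
  have "((\<lambda>y::real. 1 - exp (- y)) has_field_derivative 1) (at 0)"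
    by (auto intro!: derivative_eq_intros)
  then show "((\<lambda>y::real. (1 - exp (- y)) / y) \<longlongrightarrow> 1) (at 0)"
    by (simp add: DERIV_def)
qed

section \<open>Exponents of the covers\<close>

lemma finite_cover: "T \<in> covers d \<Longrightarrow> finite T"
  by (rule finite_subset [of _ "Pow {1..d}"]) (auto simp: covers_def)

text \<open>Every pair of [d] lies in some trace, and a trace of size s contains s choose 2
  pairs.\<close>

lemma covers_imp_pairs_le:
  assumes "T \<in> covers d"
  shows "d choose 2 \<le> (\<Sum>S\<in>T. card S choose 2)"
proof -
  have fin: "finite S" if "S \<in> T" for S
    by (rule finite_subset [of _ "{1..d}"]) (use that assms in \<open>auto simp: covers_def\<close>)
  have finT: "finite T"
    using assms by (rule finite_cover)
  have "pairs d \<subseteq> (\<Union>S\<in>T. {P. P \<subseteq> S \<and> card P = 2})"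
  proof
    fix P assume P: "P \<in> pairs d"
    then obtain S where "S \<in> T" "P \<subseteq> S"
      using assms by (auto simp: covers_def)
    then show "P \<in> (\<Union>S\<in>T. {P. P \<subseteq> S \<and> card P = 2})"
      using P by (auto simp: pairs_def)
  qed
  then have "card (pairs d) \<le> card (\<Union>S\<in>T. {P. P \<subseteq> S \<and> card P = 2})"
    using finT fin by (intro card_mono) auto
  also have "\<dots> \<le> (\<Sum>S\<in>T. card {P. P \<subseteq> S \<and> card P = 2})"
    by (rule card_UN_le [OF finT])
  also have "\<dots> = (\<Sum>S\<in>T. card S choose 2)"
    using fin by (intro sum.cong refl n_subsets)
  finally show ?thesis
    by (simp add: card_pairs)
qed

text \<open>If all traces have size 2, each pair can be covered only by itself. The large trace
  makes the exponent estimate below strict.\<close>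

lemma covers_ex_large:
  assumes "T \<in> covers d" "T \<noteq> pairs d"
  shows "\<exists>S\<in>T. 2 < card S"
proof (rule ccontr)
  assume "\<not> ?thesis"
  then have le2: "card S \<le> 2" if "S \<in> T" for S
    using that by (simp add: not_less)
  have T: "S \<subseteq> {1..d}" "card S = 2" if "S \<in> T" for S
    using assms(1) that le2 [OF that] by (auto simp: covers_def)
  have pairs: "P \<in> T" if P: "P \<in> pairs d" for P
  proof -
    obtain S where S: "S \<in> T" "P \<subseteq> S"
      using assms(1) P by (auto simp: covers_def)
    then have "P = S"
      using finite_subset [OF T(1) [OF S(1)]] T(2) [OF S(1)] P
      by (intro card_subset_eq) (auto simp: pairs_def)
    then show ?thesis
      using S by simp
  qed
  have "S \<in> pairs d" if "S \<in> T" for S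
    using T [OF that] by (simp add: pairs_def)
  then have "T = pairs d"
    using pairs by (intro equalityI subsetI)
  then show False
    using assms(2) by simp
qed

lemma real_choose_two: "2 * real (n choose 2) = real n * (real n - 1)"
proof -
  have "even (n * (n - 1))"
    by (cases n) auto
  then have "2 * (n choose 2) = n * (n - 1)"
    unfolding choose_two by (rule dvd_mult_div_cancel)
  then have "real (2 * (n choose 2)) = real (n * (n - 1))"
    by (rule arg_cong)
  then show ?thesis
    by (cases n) (simp_all add: algebra_simps)
qed

lemma cover_exponent_less:
  fixes \<delta> :: real
  assumes "d \<ge> 3" "\<delta> < 1" "T \<in> covers d" "T \<noteq> pairs d"
  shows "(\<Sum>S\<in>T. 1 + \<delta> - real (card S)) < max (1 + \<delta> - real d) (real (d choose 2) * (\<delta> - 1))"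
proof -
  \<comment> \<open>In these terms the exponent of \<open>T\<close> is \<open>- (A + k * x)\<close>,
    and the two main exponents are \<open>- (d - 2) - x\<close> and \<open>- C * x\<close>.\<close>
  define x where "x = 1 - \<delta>"
  define k where "k = real (card T)"
  define C where "C = real (d choose 2)"
  define A where "A = (\<Sum>S\<in>T. real (card S) - 2)"
  have finT: "finite T"
    using assms(3) by (rule finite_cover)
  obtain S0 where S0: "S0 \<in> T" "2 < card S0"
    using covers_ex_large assms by blast
  then have "1 \<le> card T"
    using finT by (metis One_nat_def Suc_leI card_gt_0_iff empty_iff)
  then have k: "1 \<le> k" "k \<le> C"
    using assms(3) by (simp_all add: k_def C_def covers_def)
  have C: "2 * C = real d * (real d - 1)"
    by (simp add: C_def real_choose_two)
  \<comment> \<open>The terms of \<open>A * (d + 1) + 2 * k\<close> exceed those of the pair count by a product that is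
    nonnegative for \<open>2 \<le> card S \<le> d\<close> and positive in the interior.\<close>
  have gap: "(real (card S) - 2) * (real d + 1) + 2 - 2 * real (card S choose 2) =
      (real (card S) - 2) * (real d - real (card S))" for S :: "nat set"
    unfolding real_choose_two by (simp add: algebra_simps)
  have range: "2 \<le> card S" "card S < d" if "S \<in> T" for S
    using assms(3) that by (auto simp: covers_def)
  have "C \<le> (\<Sum>S\<in>T. real (card S choose 2))"
    using covers_imp_pairs_le [OF assms(3)] unfolding C_def by (metis of_nat_le_iff of_nat_sum)
  then have "2 * C \<le> (\<Sum>S\<in>T. 2 * real (card S choose 2))"
    by (simp add: sum_distrib_left [symmetric])
  also have "\<dots> < (\<Sum>S\<in>T. (real (card S) - 2) * (real d + 1) + 2)"
  proof (rule sum_strict_mono_ex1 [OF finT])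
    show "\<forall>S\<in>T. 2 * real (card S choose 2) \<le> (real (card S) - 2) * (real d + 1) + 2"
    proof
      fix S assume "S \<in> T"
      then have "0 \<le> (real (card S) - 2) * (real d - real (card S))"
        using range [of S] by simp
      then show "2 * real (card S choose 2) \<le> (real (card S) - 2) * (real d + 1) + 2"
        using gap [of S] by linarith
    qed
    have "0 < (real (card S0) - 2) * (real d - real (card S0))"
      using range [OF S0(1)] S0(2) by simp
    then have "2 * real (card S0 choose 2) < (real (card S0) - 2) * (real d + 1) + 2"
      using gap [of S0] by linarith
    then show "\<exists>S\<in>T. 2 * real (card S choose 2) < (real (card S) - 2) * (real d + 1) + 2"
      using S0(1) by blast
  qed
  also have "\<dots> = A * (real d + 1) + 2 * k"
    by (simp add: A_def k_def sum.distrib sum_distrib_right)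
  \<comment> \<open>This is the comparison at \<open>x = 2 / (d + 1)\<close>, multiplied by
    \<open>d + 1\<close>; both main exponents equal \<open>- 2 * C / (d + 1)\<close> there.\<close>
  finally have key: "2 * C < A * (real d + 1) + 2 * k" .
  have sum: "(\<Sum>S\<in>T. 1 + \<delta> - real (card S)) = - (A + k * x)"
    by (simp add: A_def k_def x_def sum_subtractf sum.distrib algebra_simps)
  \<comment> \<open>To the right of the crossing point the comparison is with [d], and
    \<open>1 \<le> k\<close> preserves the gap. To the left it is with the pairs, and
    \<open>k \<le> C\<close> does so.\<close>
  show ?thesis
  proof (cases "2 \<le> x * (real d + 1)")
    case True
    have "(k - 1) * 2 \<le> (k - 1) * (x * (real d + 1))"
      using k True by (intro mult_left_mono) auto
    then have "0 < (A + k * x - (real d - 2) - x) * (real d + 1)"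
      using key C by (simp add: algebra_simps)
    then have "0 < A + k * x - (real d - 2) - x"
      by (simp add: zero_less_mult_iff)
    then show ?thesis
      unfolding sum by (simp add: x_def less_max_iff_disj)
  next
    case False
    have "(C - k) * (x * (real d + 1)) \<le> (C - k) * 2"
      using k False by (intro mult_left_mono) auto
    then have "0 < (A + k * x - C * x) * (real d + 1)"
      using key by (simp add: algebra_simps)
    then have "0 < A + k * x - C * x"
      by (simp add: zero_less_mult_iff)
    then show ?thesis
      unfolding sum by (simp add: x_def C_def less_max_iff_disj algebra_simps)
  qed
qed

section \<open>Asymptotics in the sparse regime\<close>

locale sparse_hypergraph =
  fixes d :: nat and \<delta> c :: real and p :: "nat \<Rightarrow> real"
  assumes d_ge: "d \<ge> 3" and \<delta>_less: "\<delta> < 1" and c_pos: "c > 0"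
    and p_asymp: "p \<sim>[sequentially] (\<lambda>n. c * real n powr (1 + \<delta> - real d))"
begin

lemma powr_tendsto_0:
  "s < 0 \<Longrightarrow> (\<lambda>n. real n powr s) \<longlonglongrightarrow> 0"
  by (rule tendsto_neg_powr [OF _ filterlim_real_sequentially])

lemma p_tendsto_0: "p \<longlonglongrightarrow> 0"
proof -
  have "(\<lambda>n. c * real n powr (1 + \<delta> - real d)) \<longlonglongrightarrow> c * 0"
    using d_ge \<delta>_less by (intro tendsto_intros powr_tendsto_0) auto
  then show ?thesis
    using tendsto_asymp_equiv_cong [OF p_asymp] by simp
qed

lemma eventually_p_pos: "\<forall>\<^sub>F n in sequentially. 0 < p n"
proof -
  have "\<forall>\<^sub>F n in sequentially. 0 < c * real n powr (1 + \<delta> - real d)"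
    using eventually_gt_at_top [of 0] by eventually_elim (simp add: c_pos)
  then show ?thesis
    using asymp_equiv_eventually_pos_iff [OF p_asymp] by eventually_elim simp
qed

lemma eventually_p_le_1: "\<forall>\<^sub>F n in sequentially. p n \<le> 1"
  using order_tendstoD(2) [OF p_tendsto_0, of 1] by (auto elim: eventually_mono)

text \<open>The left side is the expected number of hyperedges with a given trace of size
  \<open>s\<close>; the choice of the outer vertices contributes \<open>n ^ (d - s)\<close> up to
  the factorial.\<close>

lemma trace_mean_asymp:
  assumes "s \<le> d"
  shows "(\<lambda>n. real ((n - d) choose (d - s)) * p n) \<sim>[sequentially]
    (\<lambda>n. c * real n powr (1 + \<delta> - real s) / fact (d - s))"
proof -
  have "(\<lambda>n. real ((n - d) choose (d - s)) * p n) \<sim>[sequentially]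
      (\<lambda>n. real n ^ (d - s) / fact (d - s) * (c * real n powr (1 + \<delta> - real d)))"
    by (intro asymp_equiv_mult binomial_shift_asymp_equiv p_asymp)
  moreover have "\<forall>\<^sub>F n in sequentially.
      real n ^ (d - s) / fact (d - s) * (c * real n powr (1 + \<delta> - real d)) =
      c * real n powr (1 + \<delta> - real s) / fact (d - s)"
    using eventually_gt_at_top [of 0]
  proof eventually_elim
    case (elim n)
    have "real n powr (1 + \<delta> - real s) = real n powr (real (d - s) + (1 + \<delta> - real d))"
      using assms by (simp add: of_nat_diff algebra_simps)
    also have "\<dots> = real n ^ (d - s) * real n powr (1 + \<delta> - real d)"
      using elim by (simp add: powr_add powr_realpow)
    finally show ?case
      by simp
  qed
  ultimately show ?thesis
    by (subst (asm) asymp_equiv_cong [OF always_eventually]) auto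
qed

text \<open>Since \<open>s \<ge> 2\<close> and \<open>\<delta> < 1\<close>, the mean
  \<open>y\<close> tends to 0, and there the bounds \<open>1 - exp (- y)\<close> and
  \<open>y\<close> agree asymptotically.\<close>

lemma trace_prob_asymp:
  assumes "2 \<le> s" "s \<le> d"
  shows "(\<lambda>n. trace_prob d n (p n) s) \<sim>[sequentially]
    (\<lambda>n. c * real n powr (1 + \<delta> - real s) / fact (d - s))"
proof -
  define y where "y n = real ((n - d) choose (d - s)) * p n" for n
  have y_asymp: "y \<sim>[sequentially] (\<lambda>n. c * real n powr (1 + \<delta> - real s) / fact (d - s))"
    unfolding y_def using assms(2) by (rule trace_mean_asymp)
  have "(\<lambda>n. c * real n powr (1 + \<delta> - real s) / fact (d - s)) \<longlonglongrightarrow> c * 0 / fact (d - s)"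
    using assms(1) \<delta>_less by (intro tendsto_intros powr_tendsto_0) auto
  then have "y \<longlonglongrightarrow> 0"
    using tendsto_asymp_equiv_cong [OF y_asymp] by simp
  \<comment> \<open>The equivalence for \<open>1 - exp (- y)\<close> holds along the punctured
    filter \<open>at 0\<close>, so \<open>y\<close> must avoid 0. For \<open>n \<ge> 2 * d\<close>
    the binomial coefficient is positive.\<close>
  moreover have "\<forall>\<^sub>F n in sequentially. y n \<noteq> 0"
    using eventually_p_pos eventually_ge_at_top [of "2 * d"]
    by eventually_elim (auto simp: y_def)
  ultimately have "filterlim y (at 0) sequentially"
    by (simp add: filterlim_at)
  then have "(\<lambda>n. 1 - exp (- y n)) \<sim>[sequentially] y"
    by (rule asymp_equiv_compose' [OF one_minus_exp_asymp_equiv])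
  then have "(\<lambda>n. trace_prob d n (p n) s) \<sim>[sequentially] y"
  proof (rule asymp_equiv_sandwich_real)
    show "\<forall>\<^sub>F n in sequentially. trace_prob d n (p n) s \<in> {1 - exp (- y n)..y n}"
      using eventually_p_pos eventually_p_le_1
      by eventually_elim (simp add: y_def trace_prob_le trace_prob_ge)
  qed simp
  then show ?thesis
    using y_asymp by (rule asymp_equiv_trans)
qed

text \<open>The second main term: the asymptotic value of the probability that every pair of [d]
  occurs as a trace.\<close>

definition pair_term :: "nat \<Rightarrow> real" where
  "pair_term n = (c * real n powr (\<delta> - 1) / fact (d - 2)) ^ (d choose 2)"

lemma pair_term_nonneg: "0 \<le> pair_term n"
  using c_pos by (simp add: pair_term_def)

lemma trace_pairs_asymp:
  "(\<lambda>n. trace_prob d n (p n) 2 ^ (d choose 2)) \<sim>[sequentially] pair_term"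
  unfolding pair_term_def
  using trace_prob_asymp [of 2] d_ge by (intro asymp_equiv_power) (simp add: algebra_simps)

lemma bigo_main_term:
  "p \<in> O(\<lambda>n. p n + pair_term n)" "pair_term \<in> O(\<lambda>n. p n + pair_term n)"
proof -
  show "p \<in> O(\<lambda>n. p n + pair_term n)"
    using eventually_p_pos
    by (intro bigoI [of _ 1], eventually_elim) (use pair_term_nonneg in simp)
  show "pair_term \<in> O(\<lambda>n. p n + pair_term n)"
    using eventually_p_pos
    by (intro bigoI [of _ 1], eventually_elim) (simp add: pair_term_nonneg)
qed

text \<open>Both main powers are bounded by the sum, so a remainder may be compared with either one,
  without deciding which dominates.\<close>

lemma powr_bigo_main_term:
  "(\<lambda>n. real n powr (1 + \<delta> - real d)) \<in> O(\<lambda>n. p n + pair_term n)"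
  "(\<lambda>n. real n powr (real (d choose 2) * (\<delta> - 1))) \<in> O(\<lambda>n. p n + pair_term n)"
proof -
  have "(\<lambda>n. c * real n powr (1 + \<delta> - real d)) \<in> O(p)"
    using p_asymp by (intro asymp_equiv_imp_bigo) (simp add: asymp_equiv_sym)
  then have "(\<lambda>n. real n powr (1 + \<delta> - real d)) \<in> O(p)"
    using c_pos by simp
  then show "(\<lambda>n. real n powr (1 + \<delta> - real d)) \<in> O(\<lambda>n. p n + pair_term n)"
    using bigo_main_term(1) by (rule landau_o.big_trans)
  \<comment> \<open>At \<open>n = 0\<close> both sides vanish, as \<open>0 powr a\<close> is 0 and
    \<open>d choose 2\<close> is positive.\<close>
  have pow: "(real n powr (\<delta> - 1)) ^ (d choose 2) = real n powr (real (d choose 2) * (\<delta> - 1))" for n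
    using d_ge by (cases "n = 0") (simp_all add: powr_power)
  have "pair_term = (\<lambda>n. (c / fact (d - 2)) ^ (d choose 2) * (real n powr (\<delta> - 1)) ^ (d choose 2))"
    by (simp add: pair_term_def fun_eq_iff power_mult_distrib power_divide)
  also have "\<dots> = (\<lambda>n. (c / fact (d - 2)) ^ (d choose 2) * real n powr (real (d choose 2) * (\<delta> - 1)))"
    by (simp add: pow)
  finally have "(\<lambda>n. real n powr (real (d choose 2) * (\<delta> - 1))) \<in> O(pair_term)"
    using c_pos by simp
  then show "(\<lambda>n. real n powr (real (d choose 2) * (\<delta> - 1))) \<in> O(\<lambda>n. p n + pair_term n)"
    using bigo_main_term(2) by (rule landau_o.big_trans)
qed

text \<open>The product has order \<open>n powr ?a\<close>, and \<open>cover_exponent_less\<close>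
  puts \<open>?a\<close> strictly below one of the two main exponents.\<close>

lemma other_cover_smallo:
  assumes "T \<in> covers d" "T \<noteq> pairs d"
  shows "(\<lambda>n. \<Prod>S\<in>T. trace_prob d n (p n) (card S)) \<in> o(\<lambda>n. p n + pair_term n)"
proof -
  let ?a = "\<Sum>S\<in>T. 1 + \<delta> - real (card S)"
  have "(\<lambda>n. trace_prob d n (p n) (card S)) \<in> O(\<lambda>n. real n powr (1 + \<delta> - real (card S)))"
    if "S \<in> T" for S
  proof -
    have "(\<lambda>n. trace_prob d n (p n) (card S)) \<in>
        O(\<lambda>n. c * real n powr (1 + \<delta> - real (card S)) / fact (d - card S))"
      using assms(1) that by (intro asymp_equiv_imp_bigo trace_prob_asymp) (auto simp: covers_def)
    then show ?thesis
      using c_pos by simp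
  qed
  then have "(\<lambda>n. \<Prod>S\<in>T. trace_prob d n (p n) (card S)) \<in>
      O(\<lambda>n. \<Prod>S\<in>T. real n powr (1 + \<delta> - real (card S)))"
    by (rule landau_o.big_prod)
  also have "(\<lambda>n. \<Prod>S\<in>T. real n powr (1 + \<delta> - real (card S))) \<in> \<Theta>(\<lambda>n. real n powr ?a)"
  proof (intro bigthetaI_cong)
    show "\<forall>\<^sub>F n in sequentially. (\<Prod>S\<in>T. real n powr (1 + \<delta> - real (card S))) = real n powr ?a"
      using eventually_gt_at_top [of 0] by eventually_elim (simp add: powr_sum)
  qed
  also have "(\<lambda>n. real n powr ?a) \<in> o(\<lambda>n. p n + pair_term n)"
  proof -
    have smallo: "(\<lambda>n. real n powr ?a) \<in> o(\<lambda>n. real n powr b)" if "?a < b" for b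
      using that powr_smallo_iff [OF filterlim_real_sequentially] by simp
    consider "?a < 1 + \<delta> - real d" | "?a < real (d choose 2) * (\<delta> - 1)"
      using cover_exponent_less [OF d_ge \<delta>_less assms] by linarith
    then show ?thesis
    proof cases
      case 1
      then show ?thesis
        using smallo powr_bigo_main_term(1) by (blast intro: landau_o.small_big_trans)
    next
      case 2
      then show ?thesis
        using smallo powr_bigo_main_term(2) by (blast intro: landau_o.small_big_trans)
    qed
  qed
  finally show ?thesis .
qed

lemma pairs_in_covers: "pairs d \<in> covers d"
  using d_ge by (auto simp: covers_def card_pairs) (auto simp: pairs_def)

end

section \<open>Sandwiching the clique probability\<close>

theorem theorem6:
  fixes d :: nat and \<delta> c :: real and p \<epsilon> :: "nat \<Rightarrow> real"
  assumes "d \<ge> 3" and "\<delta> < 1" and "c > 0"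
    and "\<epsilon> \<in> o(\<lambda>_. 1)"
    and "\<forall>\<^sub>F n in sequentially. p n = (c + \<epsilon> n) * real n powr (- real d + 1 + \<delta>)"
  shows "\<exists>\<eta> :: nat \<Rightarrow> real. \<eta> \<in> o(\<lambda>_. 1) \<and>
    (\<forall>\<^sub>F n in sequentially.
       proj_clique_prob d n (p n) =
         (1 + \<eta> n) * (p n + (c * real n powr (\<delta> - 1) / fact (d - 2)) ^ (d choose 2)))"
proof -
  have "\<epsilon> \<longlonglongrightarrow> 0"
    using smalloD_tendsto [OF assms(4)] by simp
  then have "(\<lambda>n. c + \<epsilon> n) \<longlonglongrightarrow> c"
    using tendsto_add [OF tendsto_const [of c]] by fastforce
  then have "(\<lambda>n. c + \<epsilon> n) \<sim>[sequentially] (\<lambda>_. c)"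
    using assms(3) by (simp add: tendsto_imp_asymp_equiv_const)
  then have "(\<lambda>n. (c + \<epsilon> n) * real n powr (- real d + 1 + \<delta>)) \<sim>[sequentially]
      (\<lambda>n. c * real n powr (- real d + 1 + \<delta>))"
    by (intro asymp_equiv_mult asymp_equiv_refl)
  \<comment> \<open>Asymptotic equivalence absorbs both \<open>\<epsilon>\<close> and the finitely
    many \<open>n\<close> at which the formula for \<open>p\<close> may fail.\<close>
  then have "p \<sim>[sequentially] (\<lambda>n. c * real n powr (- real d + 1 + \<delta>))"
    using asymp_equiv_cong [OF assms(5) always_eventually] by blast
  then interpret sparse_hypergraph d \<delta> c p
    using assms by unfold_locales (simp_all add: algebra_simps)
  have asymp: "(\<lambda>n. proj_clique_prob d n (p n)) \<sim>[sequentially] (\<lambda>n. p n + pair_term n)"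
  proof -
    let ?r = "\<lambda>n. trace_prob d n (p n) 2 ^ (d choose 2)"
    let ?w = "\<lambda>T n. \<Prod>S\<in>T. trace_prob d n (p n) (card S)"
    have r_diff: "(\<lambda>n. ?r n - pair_term n) \<in> o(\<lambda>n. p n + pair_term n)"
      using asymp_equiv_imp_diff_smallo [OF trace_pairs_asymp] bigo_main_term(2)
      by (rule landau_o.small_big_trans)
    have "(\<lambda>n. p n * ?r n) \<in> o(\<lambda>n. 1 * (p n + pair_term n))"
    proof (rule landau_o.small_big_mult)
      show "p \<in> o(\<lambda>_. 1)"
        using p_tendsto_0 by (simp add: smalloI_tendsto)
      show "?r \<in> O(\<lambda>n. p n + pair_term n)"
        using asymp_equiv_imp_bigo [OF trace_pairs_asymp] bigo_main_term(2)
        by (rule landau_o.big_trans)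
    qed
    \<comment> \<open>This function is the lower bound \<open>p n + (1 - p n) * ?r n\<close> minus
      the main term.\<close>
    then have "(\<lambda>n. (?r n - pair_term n) - p n * ?r n) \<in> o(\<lambda>n. p n + pair_term n)"
      by (intro sum_in_smallo(2) [OF r_diff]) simp
    then have lower: "(\<lambda>n. p n + (1 - p n) * ?r n) \<sim>[sequentially] (\<lambda>n. p n + pair_term n)"
      by (simp add: asymp_equiv_altdef algebra_simps)
    have w_pairs: "?w (pairs d) n = ?r n" for n
      unfolding card_pairs [symmetric] prod_constant [symmetric]
      by (intro prod.cong) (auto simp: pairs_def)
    have "(\<lambda>n. \<Sum>T\<in>covers d - {pairs d}. ?w T n) \<in> o(\<lambda>n. p n + pair_term n)"
      by (intro big_sum_in_smallo) (auto intro: other_cover_smallo)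
    \<comment> \<open>This function is the upper bound minus the main term, once the cover by all
      pairs is split off the sum.\<close>
    then have "(\<lambda>n. (?r n - pair_term n) + (\<Sum>T\<in>covers d - {pairs d}. ?w T n)) \<in> o(\<lambda>n. p n + pair_term n)"
      by (rule sum_in_smallo(1) [OF r_diff])
    moreover have "(\<Sum>T\<in>covers d. ?w T n) = ?r n + (\<Sum>T\<in>covers d - {pairs d}. ?w T n)" for n
      using sum.remove [OF finite_covers pairs_in_covers, of "\<lambda>T. ?w T n"] w_pairs by simp
    ultimately have upper: "(\<lambda>n. p n + (\<Sum>T\<in>covers d. ?w T n)) \<sim>[sequentially] (\<lambda>n. p n + pair_term n)"
      by (simp add: asymp_equiv_altdef algebra_simps)
    show ?thesis
    proof (rule asymp_equiv_sandwich_real [OF lower upper])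
      show "\<forall>\<^sub>F n in sequentially. proj_clique_prob d n (p n) \<in>
          {p n + (1 - p n) * ?r n..p n + (\<Sum>T\<in>covers d. ?w T n)}"
        using eventually_p_pos eventually_p_le_1 eventually_ge_at_top [of d]
        by eventually_elim (use d_ge in \<open>simp add: proj_clique_prob_le proj_clique_prob_ge\<close>)
    qed
  qed
  let ?D = "\<lambda>n. p n + pair_term n"
  \<comment> \<open>The witness is the relative error; its denominator is eventually
    positive.\<close>
  define \<eta> where "\<eta> n = (proj_clique_prob d n (p n) - ?D n) / ?D n" for n
  have pos: "\<forall>\<^sub>F n in sequentially. 0 < ?D n"
    using eventually_p_pos by eventually_elim (simp add: add_pos_nonneg pair_term_nonneg)
  have "(\<lambda>n. proj_clique_prob d n (p n) - ?D n) \<in> o(?D)"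
    using asymp by (rule asymp_equiv_imp_diff_smallo)
  then have "\<eta> \<longlonglongrightarrow> 0"
    unfolding \<eta>_def by (rule smalloD_tendsto)
  then have "\<eta> \<in> o(\<lambda>_. 1)"
    by (simp add: smalloI_tendsto)
  moreover have "\<forall>\<^sub>F n in sequentially. proj_clique_prob d n (p n) = (1 + \<eta> n) * ?D n"
    using pos by eventually_elim (simp add: \<eta>_def field_simps)
  ultimately show ?thesis
    unfolding pair_term_def by blast
qed

end
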